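(* Let $\nabla$ be an equiaffine connection with components $\Gamma^i_{jk}$ in a coordinate chart of an $n$-dimensional manifold. If $\Gamma^i_{jk}$ is a solution of at least one of the two (completely integrable) Riccati PDE systems $$\frac{\partial}{\partial x^p}\Gamma^l_{is}+ \Gamma^l_{pn} \Gamma^n_{is}=0\quad (\text{all } p,l,i,s),\qquad\qquad \frac{\partial}{\partial x^p}\Gamma^l_{is}- \Gamma^l_{sn} \Gamma^n_{ip}=0\quad (\text{all } p,l,i,s),$$ then $\Gamma^i_{jk}$ is a solution of the Ricci-flatness PDE system $$R_{ik} := \frac{\partial}{\partial x^l}\Gamma^l_{ik} - \frac{\partial}{\partial x^k}\Gamma^l_{il}+ \Gamma^l_{ls} \Gamma^s_{ik} - \Gamma^l_{ks} \Gamma^s_{il}=0\quad(\text{all } i,k).$$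
   Context: Summation over repeated indices from $1$ to the dimension is understood (including the dummy index $n$ in the products). A torsion-free affine connection $\nabla$ (so $\Gamma^i_{jk}=\Gamma^i_{kj}$) is called (locally) equiaffine if locally there is a volume form (nonvanishing $n$-form) that is parallel with respect to $\nabla$. The components $\Gamma^i_{jk}$ are of class $C^\infty$. *)

theory Defs
  imports "HOL-Analysis.Analysis"
begin

text \<open>
  A chart of an \<open>n\<close>-dimensional manifold is represented by its open coordinate image
  \<open>U \<subseteq> \<real>\<^sup>n\<close>, where \<open>n = CARD('n)\<close>.
\<close>

definition pd :: "'n::finite \<Rightarrow> (real^'n \<Rightarrow> real) \<Rightarrow> real^'n \<Rightarrow> real" where
  "pd p f x = deriv (\<lambda>t. f (x + t *\<^sub>R axis p 1)) 0"

primrec Ck_on :: "nat \<Rightarrow> (real^'n::finite) set \<Rightarrow> (real^'n \<Rightarrow> real) \<Rightarrow> bool" where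
  "Ck_on 0 U f \<longleftrightarrow> continuous_on U f"
| "Ck_on (Suc k) U f \<longleftrightarrow> f differentiable_on U \<and> (\<forall>p. Ck_on k U (pd p f))"

definition smooth_on :: "(real^'n::finite) set \<Rightarrow> (real^'n \<Rightarrow> real) \<Rightarrow> bool" where
  "smooth_on U f \<longleftrightarrow> (\<forall>k. Ck_on k U f)"

text \<open>
  \<open>\<Gamma> l i s x\<close> is the component with upper index \<open>l\<close> and lower indices \<open>i\<close>, \<open>s\<close> at the point \<open>x\<close>,
  with the convention that the covariant derivative of the coordinate field \<open>\<partial>\<^sub>s\<close> along \<open>\<partial>\<^sub>i\<close>
  is the sum over \<open>l\<close> of \<open>\<Gamma> l i s \<partial>\<^sub>l\<close>.
\<close>

type_synonym 'n christoffel = "'n \<Rightarrow> 'n \<Rightarrow> 'n \<Rightarrow> real^'n \<Rightarrow> real"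

definition affine_connection_on :: "(real^'n::finite) set \<Rightarrow> 'n christoffel \<Rightarrow> bool" where
  "affine_connection_on U \<Gamma> \<longleftrightarrow> (\<forall>l i s. smooth_on U (\<Gamma> l i s))"

definition torsion_free_on :: "(real^'n::finite) set \<Rightarrow> 'n christoffel \<Rightarrow> bool" where
  "torsion_free_on U \<Gamma> \<longleftrightarrow> (\<forall>x\<in>U. \<forall>i j k. \<Gamma> i j k x = \<Gamma> i k j x)"

text \<open>
  Forms of top degree: the \<open>n\<close> argument slots are labelled by the index type \<open>'n\<close> itself.
\<close>

definition alternating_form :: "(('n::finite \<Rightarrow> real^'n) \<Rightarrow> real) \<Rightarrow> bool" where
  "alternating_form w \<longleftrightarrow>
     (\<forall>v a. linear (\<lambda>u. w (v(a := u)))) \<and>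
     (\<forall>v a b. a \<noteq> b \<and> v a = v b \<longrightarrow> w v = 0)"

definition form_component ::
  "(real^'n::finite \<Rightarrow> ('n \<Rightarrow> real^'n) \<Rightarrow> real) \<Rightarrow> ('n \<Rightarrow> 'n) \<Rightarrow> real^'n \<Rightarrow> real" where
  "form_component \<omega> J x = \<omega> x (\<lambda>a. axis (J a) 1)"

definition volume_form_on ::
  "(real^'n::finite) set \<Rightarrow> (real^'n \<Rightarrow> ('n \<Rightarrow> real^'n) \<Rightarrow> real) \<Rightarrow> bool" where
  "volume_form_on V \<omega> \<longleftrightarrow>
     (\<forall>x\<in>V. alternating_form (\<omega> x) \<and> (\<exists>v. \<omega> x v \<noteq> 0)) \<and>
     (\<forall>J. smooth_on V (form_component \<omega> J))"

text \<open>
  Component \<open>J\<close> of the covariant derivative of \<open>\<omega>\<close> along the coordinate field \<open>\<partial>\<^sub>p\<close>,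
  that is, the Leibniz formula
  \<open>(\<nabla>\<^sub>X \<omega>)(Y\<^sub>1, \<dots>, Y\<^sub>n) = X(\<omega>(Y\<^sub>1, \<dots>, Y\<^sub>n)) - \<Sum>\<^sub>a \<omega>(Y\<^sub>1, \<dots>, \<nabla>\<^sub>X Y\<^sub>a, \<dots>, Y\<^sub>n)\<close>
  evaluated on coordinate fields.
\<close>

definition cov_deriv_form ::
  "'n::finite christoffel \<Rightarrow> (real^'n \<Rightarrow> ('n \<Rightarrow> real^'n) \<Rightarrow> real) \<Rightarrow> 'n \<Rightarrow> ('n \<Rightarrow> 'n) \<Rightarrow> real^'n \<Rightarrow> real"
  where
  "cov_deriv_form \<Gamma> \<omega> p J x =
     pd p (form_component \<omega> J) x
     - (\<Sum>a\<in>UNIV. \<Sum>l\<in>UNIV. \<Gamma> l p (J a) x * form_component \<omega> (J(a := l)) x)"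

definition parallel_on ::
  "(real^'n::finite) set \<Rightarrow> 'n christoffel \<Rightarrow> (real^'n \<Rightarrow> ('n \<Rightarrow> real^'n) \<Rightarrow> real) \<Rightarrow> bool" where
  "parallel_on V \<Gamma> \<omega> \<longleftrightarrow> (\<forall>x\<in>V. \<forall>p J. cov_deriv_form \<Gamma> \<omega> p J x = 0)"

definition equiaffine_on :: "(real^'n::finite) set \<Rightarrow> 'n christoffel \<Rightarrow> bool" where
  "equiaffine_on U \<Gamma> \<longleftrightarrow>
     affine_connection_on U \<Gamma> \<and> torsion_free_on U \<Gamma> \<and>
     (\<forall>x\<in>U. \<exists>V \<omega>. open V \<and> x \<in> V \<and> V \<subseteq> U \<and> volume_form_on V \<omega> \<and> parallel_on V \<Gamma> \<omega>)"

definition riccati_system_1 :: "(real^'n::finite) set \<Rightarrow> 'n christoffel \<Rightarrow> bool" where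
  "riccati_system_1 U \<Gamma> \<longleftrightarrow>
     (\<forall>x\<in>U. \<forall>p l i s. pd p (\<Gamma> l i s) x + (\<Sum>n\<in>UNIV. \<Gamma> l p n x * \<Gamma> n i s x) = 0)"

definition riccati_system_2 :: "(real^'n::finite) set \<Rightarrow> 'n christoffel \<Rightarrow> bool" where
  "riccati_system_2 U \<Gamma> \<longleftrightarrow>
     (\<forall>x\<in>U. \<forall>p l i s. pd p (\<Gamma> l i s) x - (\<Sum>n\<in>UNIV. \<Gamma> l s n x * \<Gamma> n i p x) = 0)"

definition ricci :: "'n::finite christoffel \<Rightarrow> 'n \<Rightarrow> 'n \<Rightarrow> real^'n \<Rightarrow> real" where
  "ricci \<Gamma> i k x =
     (\<Sum>l\<in>UNIV. pd l (\<Gamma> l i k) x) - (\<Sum>l\<in>UNIV. pd k (\<Gamma> l i l) x)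
     + (\<Sum>l\<in>UNIV. \<Sum>s\<in>UNIV. \<Gamma> l l s x * \<Gamma> s i k x)
     - (\<Sum>l\<in>UNIV. \<Sum>s\<in>UNIV. \<Gamma> l k s x * \<Gamma> s i l x)"

end

theory Submission
  imports Defs
begin

text \<open>
  Either system rewrites the two derivative terms of the Ricci tensor as quadratic terms in \<open>\<Gamma>\<close>:
  under the first system \<open>\<partial>\<^sub>l \<Gamma>\<^sup>l\<^sub>i\<^sub>k\<close> cancels \<open>\<Gamma>\<^sup>l\<^sub>l\<^sub>s \<Gamma>\<^sup>s\<^sub>i\<^sub>k\<close> and \<open>\<partial>\<^sub>k \<Gamma>\<^sup>l\<^sub>i\<^sub>l\<close> cancels
  \<open>\<Gamma>\<^sup>l\<^sub>k\<^sub>s \<Gamma>\<^sup>s\<^sub>i\<^sub>l\<close>; under the second the roles of the two quadratic terms are exchanged.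
\<close>

lemma riccati_system_1_imp_ricci_flat:
  assumes "riccati_system_1 U \<Gamma>" and "x \<in> U"
  shows "ricci \<Gamma> i k x = 0"
proof -
  have "pd p (\<Gamma> l i s) x = - (\<Sum>n\<in>UNIV. \<Gamma> l p n x * \<Gamma> n i s x)" for p l i s
    using assms unfolding riccati_system_1_def by (simp add: eq_neg_iff_add_eq_0)
  \<comment> \<open>Setting \<open>p = l\<close>, \<open>s = k\<close> and then
    \<open>p = k\<close>, \<open>s = l\<close> gives minus the two double sums of
    \<open>ricci\<close>, index for index; \<open>sum_negf\<close> pulls the signs out of the sums
    over \<open>l\<close>.\<close>
  then show ?thesis
    by (simp add: ricci_def sum_negf)
qed

lemma riccati_system_2_imp_ricci_flat:
  assumes "riccati_system_2 U \<Gamma>" and "x \<in> U"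
  shows "ricci \<Gamma> i k x = 0"
proof -
  have "pd p (\<Gamma> l i s) x = (\<Sum>n\<in>UNIV. \<Gamma> l s n x * \<Gamma> n i p x)" for p l i s
    using assms unfolding riccati_system_2_def by simp
  \<comment> \<open>Compared with the first system, \<open>p\<close> and \<open>s\<close> trade
    places in the product and the sign flips, so \<open>p = l\<close>, \<open>s = k\<close> now
    matches the subtracted double sum.\<close>
  then show ?thesis
    by (simp add: ricci_def)
qed

theorem theorem2p9:
  fixes U :: "(real^'n::finite) set" and \<Gamma> :: "'n christoffel"
  assumes "open U"
    and "equiaffine_on U \<Gamma>"
    and "riccati_system_1 U \<Gamma> \<or> riccati_system_2 U \<Gamma>"
  shows "\<forall>x\<in>U. \<forall>i k. ricci \<Gamma> i k x = 0"
  using assms(3) riccati_system_1_imp_ricci_flat riccati_system_2_imp_ricci_flat by blast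

end
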